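(* A preference relation $\succeq$ on $\mathbb{R}_{++}\times L^\infty_+$ is a monotone stationary time preference (MSTP) if and only if there exist a monotone additive statistic $\Phi\colon L^\infty_+\to\mathbb{R}$, a constant $r>0$, and a continuous and strictly increasing function $u\colon\mathbb{R}_{++}\to\mathbb{R}_{++}$ such that $\succeq$ is represented by $$V(x,T)=u(x)\cdot e^{-r\Phi(T)},$$ i.e. $(x,T)\succeq(y,S)$ if and only if $V(x,T)\ge V(y,S)$.
   Context: $L^\infty_+$ is the set of non-negative bounded random variables on a fixed nonatomic probability space; constants $t\ge0$ are identified with constant random variables. $\mathbb{R}_{++}=(0,\infty)$, $\mathbb{R}_+=[0,\infty)$. $S\ge_1T$ denotes first-order stochastic dominance: $\mathbb{P}[S\le t]\le\mathbb{P}[T\le t]$ for all $t$. A time lottery is a pair $(x,T)\in\mathbb{R}_{++}\times L^\infty_+$ (payoff $x$ received at random time $T$). A preference relation is a complete and transitive binary relation; $\succ$ and $\sim$ are its strict and indifference parts. A map $\Phi\colon L^\infty_+\to\mathbb{R}$ is a monotone additive statistic if: $\Phi(T)=\Phi(S)$ whenever $T,S$ have the same distribution; $\Phi(c)=c$ for every constant $c\ge0$; $\Phi(T+S)=\Phi(T)+\Phi(S)$ whenever $T,S$ are independent; and $S\ge_1T$ implies $\Phi(S)\ge\Phi(T)$. A preference relation $\succeq$ on $\mathbb{R}_{++}\times L^\infty_+$ is a monotone stationary time preference (MSTP) if it satisfies: 1. (More is Better) If $x>y$ then $(x,T)\succ(y,T)$. 2. (Earlier is Better) If $s>t$ are deterministic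 times then $(x,t)\succ(x,s)$, and if $S\ge_1T$ then $(x,T)\succeq(x,S)$. 3. (Stochastic Stationarity) If $(x,T)\succeq(y,S)$ then $(x,T+D)\succeq(y,S+D)$ for any $D\in L^\infty_+$ that is independent from $T$ and $S$. 4. (Continuity) For any $(y,S)$, the sets $\{(x,t):(x,t)\succeq(y,S)\}$ and $\{(x,t):(x,t)\preceq(y,S)\}$ (with $t$ deterministic) are closed in $\mathbb{R}_{++}\times\mathbb{R}_+$. *)

theory Defs
  imports "HOL-Probability.Probability"
begin

locale nonatomic_prob_space = prob_space M for M :: "'a measure" +
  assumes nonatomic:
    "\<And>A. A \<in> sets M \<Longrightarrow> measure M A > 0 \<Longrightarrow>
       \<exists>B\<in>sets M. B \<subseteq> A \<and> 0 < measure M B \<and> measure M B < measure M A"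

(* Random variables are represented by functions, not by almost-sure equivalence classes. *)
definition Linf_nonneg :: "'a measure \<Rightarrow> ('a \<Rightarrow> real) set" where
  "Linf_nonneg M = {T \<in> borel_measurable M. \<exists>C. AE \<omega> in M. 0 \<le> T \<omega> \<and> T \<omega> \<le> C}"

definition fosd :: "'a measure \<Rightarrow> ('a \<Rightarrow> real) \<Rightarrow> ('a \<Rightarrow> real) \<Rightarrow> bool" where
  "fosd M S T \<longleftrightarrow>
     (\<forall>t. measure M {\<omega> \<in> space M. S \<omega> \<le> t} \<le> measure M {\<omega> \<in> space M. T \<omega> \<le> t})"

definition monotone_additive_statistic :: "'a measure \<Rightarrow> (('a \<Rightarrow> real) \<Rightarrow> real) \<Rightarrow> bool" where
  "monotone_additive_statistic M \<Phi> \<longleftrightarrow>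
     (\<forall>S\<in>Linf_nonneg M. \<forall>T\<in>Linf_nonneg M. distr M borel T = distr M borel S \<longrightarrow> \<Phi> T = \<Phi> S) \<and>
     (\<forall>c\<ge>0. \<Phi> (\<lambda>_. c) = c) \<and>
     (\<forall>S\<in>Linf_nonneg M. \<forall>T\<in>Linf_nonneg M. prob_space.indep_var M borel T borel S \<longrightarrow>
        \<Phi> (\<lambda>\<omega>. T \<omega> + S \<omega>) = \<Phi> T + \<Phi> S) \<and>
     (\<forall>S\<in>Linf_nonneg M. \<forall>T\<in>Linf_nonneg M. fosd M S T \<longrightarrow> \<Phi> S \<ge> \<Phi> T)"

type_synonym 'a time_lottery = "real \<times> ('a \<Rightarrow> real)"

definition time_lotteries :: "'a measure \<Rightarrow> 'a time_lottery set" where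
  "time_lotteries M = {0<..} \<times> Linf_nonneg M"

(* In the relations below, R p q reads "p is weakly preferred to q"; only the values of R on
   time lotteries matter. *)

definition preference_relation_on :: "'b set \<Rightarrow> ('b \<Rightarrow> 'b \<Rightarrow> bool) \<Rightarrow> bool" where
  "preference_relation_on A R \<longleftrightarrow> (\<forall>p\<in>A. \<forall>q\<in>A. R p q \<or> R q p) \<and> transp_on A R"

definition strict_part :: "('b \<Rightarrow> 'b \<Rightarrow> bool) \<Rightarrow> 'b \<Rightarrow> 'b \<Rightarrow> bool" where
  "strict_part R p q \<longleftrightarrow> R p q \<and> \<not> R q p"

definition more_is_better :: "'a measure \<Rightarrow> ('a time_lottery \<Rightarrow> 'a time_lottery \<Rightarrow> bool) \<Rightarrow> bool" where
  "more_is_better M R \<longleftrightarrow>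
     (\<forall>x>0. \<forall>y>0. \<forall>T\<in>Linf_nonneg M. x > y \<longrightarrow> strict_part R (x, T) (y, T))"

definition earlier_is_better :: "'a measure \<Rightarrow> ('a time_lottery \<Rightarrow> 'a time_lottery \<Rightarrow> bool) \<Rightarrow> bool" where
  "earlier_is_better M R \<longleftrightarrow>
     (\<forall>x>0. \<forall>s\<ge>0. \<forall>t\<ge>0. s > t \<longrightarrow> strict_part R (x, \<lambda>_. t) (x, \<lambda>_. s)) \<and>
     (\<forall>x>0. \<forall>S\<in>Linf_nonneg M. \<forall>T\<in>Linf_nonneg M. fosd M S T \<longrightarrow> R (x, T) (x, S))"

definition stochastic_stationarity :: "'a measure \<Rightarrow> ('a time_lottery \<Rightarrow> 'a time_lottery \<Rightarrow> bool) \<Rightarrow> bool" where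
  "stochastic_stationarity M R \<longleftrightarrow>
     (\<forall>x>0. \<forall>y>0. \<forall>T\<in>Linf_nonneg M. \<forall>S\<in>Linf_nonneg M. \<forall>D\<in>Linf_nonneg M.
        R (x, T) (y, S) \<longrightarrow>
        prob_space.indep_var M borel D borel T \<longrightarrow>
        prob_space.indep_var M borel D borel S \<longrightarrow>
        R (x, \<lambda>\<omega>. T \<omega> + D \<omega>) (y, \<lambda>\<omega>. S \<omega> + D \<omega>))"

definition preference_continuity :: "'a measure \<Rightarrow> ('a time_lottery \<Rightarrow> 'a time_lottery \<Rightarrow> bool) \<Rightarrow> bool" where
  "preference_continuity M R \<longleftrightarrow>
     (\<forall>y>0. \<forall>S\<in>Linf_nonneg M.
        closedin (top_of_set ({0<..} \<times> {0..}))
          {(x, t) \<in> {0<..} \<times> {0::real..}. R (x, \<lambda>_. t) (y, S)} \<and>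
        closedin (top_of_set ({0<..} \<times> {0..}))
          {(x, t) \<in> {0<..} \<times> {0::real..}. R (y, S) (x, \<lambda>_. t)})"

definition mstp :: "'a measure \<Rightarrow> ('a time_lottery \<Rightarrow> 'a time_lottery \<Rightarrow> bool) \<Rightarrow> bool" where
  "mstp M R \<longleftrightarrow>
     preference_relation_on (time_lotteries M) R \<and>
     more_is_better M R \<and> earlier_is_better M R \<and>
     stochastic_stationarity M R \<and> preference_continuity M R"

definition represents_on :: "'b set \<Rightarrow> ('b \<Rightarrow> 'b \<Rightarrow> bool) \<Rightarrow> ('b \<Rightarrow> real) \<Rightarrow> bool" where
  "represents_on A R V \<longleftrightarrow> (\<forall>p\<in>A. \<forall>q\<in>A. R p q \<longleftrightarrow> V p \<ge> V q)"

end

theory Submission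
  imports Defs
begin

text \<open>
  Every lottery \<open>(x, T)\<close> is indifferent to a deterministic one \<open>(x, t)\<close>, by connectedness of the
  time axis. On deterministic lotteries stationarity is an equivalence, and for any two payoffs
  there are delays \<open>a\<close>, \<open>b\<close> with \<open>(x, a) \<sim> (y, b)\<close>; so the difference \<open>a - b\<close> with \<open>y = 1\<close> serves as
  the logarithm of \<open>u x\<close>, with \<open>r = 1\<close>. Adding an independent \<open>T\<close> to both sides of
  \<open>(x, a) \<sim> (y, b)\<close> shows that the certainty equivalent \<open>t\<close> does not depend on the payoff, and
  adding an independent time to \<open>(1, T) \<sim> (1, t)\<close> shows that it is additive.
\<close>

section \<open>Bounded times, independence of constants, first-order dominance\<close>

lemma Linf_nonneg_const: "0 \<le> c \<Longrightarrow> (\<lambda>_. c) \<in> Linf_nonneg M"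
  unfolding Linf_nonneg_def by auto

lemma Linf_nonneg_add:
  assumes "T \<in> Linf_nonneg M" "S \<in> Linf_nonneg M"
  shows "(\<lambda>\<omega>. T \<omega> + S \<omega>) \<in> Linf_nonneg M"
proof -
  obtain C D where "AE \<omega> in M. 0 \<le> T \<omega> \<and> T \<omega> \<le> C" "AE \<omega> in M. 0 \<le> S \<omega> \<and> S \<omega> \<le> D"
    using assms unfolding Linf_nonneg_def by blast
  then have "AE \<omega> in M. 0 \<le> T \<omega> + S \<omega> \<and> T \<omega> + S \<omega> \<le> C + D"
    by eventually_elim auto
  then show ?thesis
    using assms unfolding Linf_nonneg_def by auto
qed

text \<open>The preimages under a constant are only the empty set and the whole space, each
  independent of every event. Both families of preimages are intersection-stable, so the product
  rule on them extends to the generated sigma-algebras.\<close>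

lemma (in prob_space) indep_var_const_right:
  assumes "random_variable N X"
  shows "indep_var N X borel (\<lambda>_. c)"
  unfolding indep_var_eq
proof (intro conjI indep_set_sigma_sets indep_setI)
  let ?A = "{X -` A \<inter> space M |A. A \<in> sets N}"
  let ?B = "{(\<lambda>_. c) -` A \<inter> space M |A. A \<in> sets borel}"
  show "?A \<subseteq> events"
    using assms by (auto simp: measurable_sets)
  show "?B \<subseteq> events"
    by (auto simp: vimage_const)
  show "prob (a \<inter> b) = prob a * prob b" if "a \<in> ?A" "b \<in> ?B" for a b
  proof -
    have "a \<subseteq> space M" using that by auto
    moreover have "b = space M \<or> b = {}" using that by (auto simp: vimage_const split: if_splits)
    ultimately show ?thesis by (auto simp: prob_space Int_absorb2)
  qed
  show "Int_stable ?A"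
  proof (rule Int_stableI)
    fix a b assume "a \<in> ?A" "b \<in> ?A"
    then obtain A B where "a = X -` A \<inter> space M" "b = X -` B \<inter> space M" "A \<in> sets N" "B \<in> sets N"
      by auto
    then have "a \<inter> b = X -` (A \<inter> B) \<inter> space M" "A \<inter> B \<in> sets N" by auto
    then show "a \<inter> b \<in> ?A" by blast
  qed
  show "Int_stable ?B"
  proof (rule Int_stableI)
    fix a b assume "a \<in> ?B" "b \<in> ?B"
    then obtain A B where "a = (\<lambda>_. c) -` A \<inter> space M" "b = (\<lambda>_. c) -` B \<inter> space M"
      "A \<in> sets borel" "B \<in> sets borel"
      by auto
    then have "a \<inter> b = (\<lambda>_. c) -` (A \<inter> B) \<inter> space M" "A \<inter> B \<in> sets borel" by auto
    then show "a \<inter> b \<in> ?B" by blast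
  qed
qed (use assms in auto)

lemma (in prob_space) indep_var_commute:
  assumes "indep_var N X L Y"
  shows "indep_var L Y N X"
  using assms unfolding indep_var_eq indep_sets2_eq
  by (elim conjE, intro conjI ballI) (subst Int_commute, subst mult.commute, blast | assumption)+

lemma (in prob_space) fosd_if_AE_le:
  assumes "S \<in> borel_measurable M" "T \<in> borel_measurable M" "AE \<omega> in M. T \<omega> \<le> S \<omega>"
  shows "fosd M S T"
  unfolding fosd_def
proof (intro allI finite_measure_mono_AE)
  fix t
  show "AE \<omega> in M. \<omega> \<in> {\<omega> \<in> space M. S \<omega> \<le> t} \<longrightarrow> \<omega> \<in> {\<omega> \<in> space M. T \<omega> \<le> t}"
    using assms(3) by eventually_elim auto
qed (use assms in measurable)

text \<open>Equality of distributions is symmetric, so this yields dominance both ways; law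
  invariance of a statistic then follows from its monotonicity.\<close>

lemma fosd_if_distr_eq:
  assumes "S \<in> borel_measurable M" "T \<in> borel_measurable M"
    and "distr M borel S = distr M borel T"
  shows "fosd M S T"
proof -
  have "measure M {\<omega> \<in> space M. X \<omega> \<le> t} = measure (distr M borel X) {..t}"
    if "X \<in> borel_measurable M" for X :: "'a \<Rightarrow> real" and t
    using that by (subst measure_distr) (auto intro!: arg_cong[where f = "measure M"])
  then show ?thesis
    using assms by (simp add: fosd_def)
qed

section \<open>Direct consequences of the axioms\<close>

locale mstp_preference = prob_space M for M :: "'a measure" +
  fixes R :: "'a time_lottery \<Rightarrow> 'a time_lottery \<Rightarrow> bool"
  assumes mstp: "mstp M R"
begin

text \<open>With membership built in, a preference carries the side conditions of the axioms along,
  and transitivity holds for arbitrary pairs.\<close>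

definition weakly_preferred :: "'a time_lottery \<Rightarrow> 'a time_lottery \<Rightarrow> bool" (infix "\<succeq>" 50) where
  "p \<succeq> q \<longleftrightarrow> p \<in> time_lotteries M \<and> q \<in> time_lotteries M \<and> R p q"

definition indifferent :: "'a time_lottery \<Rightarrow> 'a time_lottery \<Rightarrow> bool" (infix "\<sim>" 50) where
  "p \<sim> q \<longleftrightarrow> p \<succeq> q \<and> q \<succeq> p"

lemma lottery_iff [simp]: "(x, T) \<in> time_lotteries M \<longleftrightarrow> 0 < x \<and> T \<in> Linf_nonneg M"
  by (auto simp: time_lotteries_def)

lemma const_lottery: "0 \<le> t \<Longrightarrow> 0 < x \<Longrightarrow> (x, \<lambda>_. t) \<in> time_lotteries M"
  by (simp add: Linf_nonneg_const)

lemma weakly_preferred_trans [trans]: "p \<succeq> q \<Longrightarrow> q \<succeq> s \<Longrightarrow> p \<succeq> s"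
  using mstp unfolding mstp_def preference_relation_on_def weakly_preferred_def
  by (blast dest: transp_onD)

lemma weakly_preferred_total:
  "p \<in> time_lotteries M \<Longrightarrow> q \<in> time_lotteries M \<Longrightarrow> p \<succeq> q \<or> q \<succeq> p"
  using mstp unfolding mstp_def preference_relation_on_def weakly_preferred_def by blast

lemma indifferent_sym: "p \<sim> q \<Longrightarrow> q \<sim> p"
  by (simp add: indifferent_def)

lemma indifferent_trans [trans]: "p \<sim> q \<Longrightarrow> q \<sim> s \<Longrightarrow> p \<sim> s"
  unfolding indifferent_def using weakly_preferred_trans by blast

lemma indifferent_cong: "p \<sim> p' \<Longrightarrow> q \<sim> q' \<Longrightarrow> p \<succeq> q \<longleftrightarrow> p' \<succeq> q'"
  unfolding indifferent_def using weakly_preferred_trans by blast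

lemma payoff_strict: "y < x \<Longrightarrow> \<not> (y, T) \<succeq> (x, T)"
  using mstp unfolding mstp_def more_is_better_def strict_part_def weakly_preferred_def by auto

lemma payoff_mono:
  assumes "y \<le> x" "0 < y" "T \<in> Linf_nonneg M"
  shows "(x, T) \<succeq> (y, T)"
  using assms payoff_strict[of y x T] weakly_preferred_total[of "(x, T)" "(y, T)"]
  by (cases "x = y") auto

text \<open>Strictness of Earlier is Better makes this an equivalence, so indifference between two
  times at one payoff forces them to be equal. All uniqueness of certainty equivalents rests on
  this.\<close>

lemma time_le_iff:
  assumes "0 < x" "0 \<le> t" "0 \<le> s"
  shows "(x, \<lambda>_. t) \<succeq> (x, \<lambda>_. s) \<longleftrightarrow> t \<le> s"
proof -
  have strict: "\<not> (x, \<lambda>_. b) \<succeq> (x, \<lambda>_. a)" if "a < b" "0 \<le> a" for a b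
    using mstp that assms(1)
    unfolding mstp_def earlier_is_better_def strict_part_def weakly_preferred_def by auto
  have total: "(x, \<lambda>_. t) \<succeq> (x, \<lambda>_. s) \<or> (x, \<lambda>_. s) \<succeq> (x, \<lambda>_. t)"
    using assms by (intro weakly_preferred_total const_lottery)
  show ?thesis
    using strict[of t s] strict[of s t] total assms by (cases t s rule: linorder_cases) auto
qed

lemma fosd_preferred:
  assumes "0 < x" "S \<in> Linf_nonneg M" "T \<in> Linf_nonneg M" "fosd M S T"
  shows "(x, T) \<succeq> (x, S)"
  using mstp assms unfolding mstp_def earlier_is_better_def weakly_preferred_def by auto

lemma stationarity:
  assumes "(x, T) \<succeq> (y, S)" "D \<in> Linf_nonneg M"
    and "indep_var borel D borel T" "indep_var borel D borel S"
  shows "(x, \<lambda>\<omega>. T \<omega> + D \<omega>) \<succeq> (y, \<lambda>\<omega>. S \<omega> + D \<omega>)"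
  using mstp assms
  unfolding mstp_def stochastic_stationarity_def weakly_preferred_def
  by (auto simp: Linf_nonneg_add)

lemma indifferent_stationarity:
  assumes "(x, T) \<sim> (y, S)" "D \<in> Linf_nonneg M"
    and "indep_var borel D borel T" "indep_var borel D borel S"
  shows "(x, \<lambda>\<omega>. T \<omega> + D \<omega>) \<sim> (y, \<lambda>\<omega>. S \<omega> + D \<omega>)"
  using assms stationarity unfolding indifferent_def by blast

lemma indep_const:
  assumes "T \<in> Linf_nonneg M"
  shows "indep_var borel T borel (\<lambda>_. c)" "indep_var borel (\<lambda>_. c) borel T"
proof -
  show *: "indep_var borel T borel (\<lambda>_. c)"
    using assms by (intro indep_var_const_right) (simp add: Linf_nonneg_def)
  show "indep_var borel (\<lambda>_. c) borel T"
    using * by (rule indep_var_commute)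
qed

text \<open>A constant delay is independent of every random time, so stationarity applies to it
  unconditionally.\<close>

lemma indifferent_delay:
  assumes "(x, T) \<sim> (y, S)" "0 \<le> d"
  shows "(x, \<lambda>\<omega>. T \<omega> + d) \<sim> (y, \<lambda>\<omega>. S \<omega> + d)"
  using assms
  by (intro indifferent_stationarity indep_const)
    (auto simp: indifferent_def weakly_preferred_def Linf_nonneg_const)

section \<open>Continuity and existence of certainty equivalents\<close>

text \<open>The closed set of the continuity axiom is pulled back along \<open>f\<close>, which
  later embeds either the payoff axis or the time axis.\<close>

lemma closedin_upper:
  assumes "continuous_on A f" "f \<in> A \<rightarrow> {0<..} \<times> {0..}" "q \<in> time_lotteries M"
  shows "closedin (top_of_set A) {a \<in> A. (fst (f a), \<lambda>_. snd (f a)) \<succeq> q}"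
proof -
  obtain y S where q: "q = (y, S)" "0 < y" "S \<in> Linf_nonneg M"
    using assms(3) by (cases q) auto
  have "closedin (top_of_set ({0<..} \<times> {0..})) {(x, t) \<in> {0<..} \<times> {0..}. R (x, \<lambda>_. t) q}"
    using mstp q unfolding mstp_def preference_continuity_def by blast
  from continuous_closedin_preimage_gen[OF assms(1,2) this]
  show ?thesis
    using assms(2) q
    by (elim back_subst[where P = "closedin _"])
      (auto simp: weakly_preferred_def Linf_nonneg_const split_beta Pi_iff mem_Times_iff)
qed

lemma closedin_lower:
  assumes "continuous_on A f" "f \<in> A \<rightarrow> {0<..} \<times> {0..}" "q \<in> time_lotteries M"
  shows "closedin (top_of_set A) {a \<in> A. q \<succeq> (fst (f a), \<lambda>_. snd (f a))}"
proof -
  obtain y S where q: "q = (y, S)" "0 < y" "S \<in> Linf_nonneg M"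
    using assms(3) by (cases q) auto
  have "closedin (top_of_set ({0<..} \<times> {0..})) {(x, t) \<in> {0<..} \<times> {0..}. R q (x, \<lambda>_. t)}"
    using mstp q unfolding mstp_def preference_continuity_def by blast
  from continuous_closedin_preimage_gen[OF assms(1,2) this]
  show ?thesis
    using assms(2) q
    by (elim back_subst[where P = "closedin _"])
      (auto simp: weakly_preferred_def Linf_nonneg_const split_beta Pi_iff mem_Times_iff)
qed

lemma closedin_payoffs:
  assumes "0 \<le> t" "q \<in> time_lotteries M"
  shows "closedin (top_of_set {0<..}) {x \<in> {0<..}. (x, \<lambda>_. t) \<succeq> q}"
    and "closedin (top_of_set {0<..}) {x \<in> {0<..}. q \<succeq> (x, \<lambda>_. t)}"
proof -
  have f: "continuous_on {0<..} (\<lambda>x::real. (x, t))" "(\<lambda>x. (x, t)) \<in> {0<..} \<rightarrow> {0<..} \<times> {0..}"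
    using assms by (auto intro!: continuous_intros)
  show "closedin (top_of_set {0<..}) {x \<in> {0<..}. (x, \<lambda>_. t) \<succeq> q}"
    using closedin_upper[OF f assms(2)] by simp
  show "closedin (top_of_set {0<..}) {x \<in> {0<..}. q \<succeq> (x, \<lambda>_. t)}"
    using closedin_lower[OF f assms(2)] by simp
qed

lemma closedin_times:
  assumes "0 < x" "q \<in> time_lotteries M"
  shows "closedin (top_of_set {0..}) {t \<in> {0..}. (x, \<lambda>_. t) \<succeq> q}"
    and "closedin (top_of_set {0..}) {t \<in> {0..}. q \<succeq> (x, \<lambda>_. t)}"
proof -
  have f: "continuous_on {0..} (Pair x)" "Pair x \<in> {0..} \<rightarrow> {0<..} \<times> {0::real..}"
    using assms by (auto intro!: continuous_intros)
  show "closedin (top_of_set {0..}) {t \<in> {0..}. (x, \<lambda>_. t) \<succeq> q}"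
    using closedin_upper[OF f assms(2)] by simp
  show "closedin (top_of_set {0..}) {t \<in> {0..}. q \<succeq> (x, \<lambda>_. t)}"
    using closedin_lower[OF f assms(2)] by simp
qed

text \<open>An intermediate value argument: the times at least as good as \<open>q\<close> and those
  at most as good are closed, cover the half-line by totality and contain \<open>0\<close> and
  \<open>c\<close> respectively, so they meet.\<close>

lemma ex_indifferent_time:
  assumes "(x, \<lambda>_. 0) \<succeq> q" "q \<succeq> (x, \<lambda>_. c)" "0 \<le> c"
  obtains t where "0 \<le> t" "(x, \<lambda>_. t) \<sim> q"
proof -
  let ?U = "{t \<in> {0..}. (x, \<lambda>_. t) \<succeq> q}" and ?L = "{t \<in> {0..}. q \<succeq> (x, \<lambda>_. t)}"
  have q: "q \<in> time_lotteries M" and x: "0 < x"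
    using assms(1) by (auto simp: weakly_preferred_def)
  have "closedin (top_of_set {0..}) ?U" "closedin (top_of_set {0..}) ?L"
    using closedin_times[OF x q] .
  moreover have "{0..} \<subseteq> ?U \<union> ?L"
    using weakly_preferred_total[OF const_lottery q] x by auto
  moreover have "0 \<in> ?U" "c \<in> ?L"
    using assms by auto
  moreover have "connected {0::real..}"
    by simp
  ultimately have "?U \<inter> ?L \<noteq> {}"
    unfolding connected_closedin by blast
  then show thesis
    using that by (auto simp: indifferent_def)
qed

lemma ex_certainty_equivalent:
  assumes "0 < x" "T \<in> Linf_nonneg M"
  obtains t where "0 \<le> t" "(x, T) \<sim> (x, \<lambda>_. t)"
proof -
  obtain C where T: "T \<in> borel_measurable M" and "AE \<omega> in M. 0 \<le> T \<omega> \<and> T \<omega> \<le> C"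
    using assms by (auto simp: Linf_nonneg_def)
  \<comment> \<open>\<open>max C 0\<close> is still an upper bound and is visibly an admissible
    time, so \<open>T\<close> lies between two constants.\<close>
  then have "AE \<omega> in M. 0 \<le> T \<omega>" "AE \<omega> in M. T \<omega> \<le> max C 0"
    by auto
  with T have "fosd M T (\<lambda>_. 0)" "fosd M (\<lambda>_. max C 0) T"
    by (auto intro!: fosd_if_AE_le)
  then have "(x, \<lambda>_. 0) \<succeq> (x, T)" "(x, T) \<succeq> (x, \<lambda>_. max C 0)"
    using assms by (auto intro!: fosd_preferred Linf_nonneg_const)
  then show thesis
    by (rule ex_indifferent_time[where c = "max C 0"]) (auto intro: that indifferent_sym)
qed

section \<open>Delays of deterministic lotteries\<close>

lemma delay_iff:
  assumes "0 < x" "0 < y" "0 \<le> t" "0 \<le> s" "0 \<le> d"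
  shows "(x, \<lambda>_. t + d) \<succeq> (y, \<lambda>_. s + d) \<longleftrightarrow> (x, \<lambda>_. t) \<succeq> (y, \<lambda>_. s)"
proof
  show "(x, \<lambda>_. t) \<succeq> (y, \<lambda>_. s) \<Longrightarrow> (x, \<lambda>_. t + d) \<succeq> (y, \<lambda>_. s + d)"
    using assms by (intro stationarity indep_const Linf_nonneg_const)
  assume *: "(x, \<lambda>_. t + d) \<succeq> (y, \<lambda>_. s + d)"
  show "(x, \<lambda>_. t) \<succeq> (y, \<lambda>_. s)"
  proof (rule ccontr)
    assume neg: "\<not> (x, \<lambda>_. t) \<succeq> (y, \<lambda>_. s)"
    \<comment> \<open>Stationarity only preserves weak preference, so a strict one is first turned into a weak
      one at a slightly smaller payoff.\<close>
    let ?A = "{z \<in> {0<..}. (x, \<lambda>_. t) \<succeq> (z, \<lambda>_. s)}"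
    have "closedin (top_of_set {0<..}) ?A"
      using assms by (intro closedin_payoffs const_lottery)
    then obtain C where C: "closed C" "?A = {0<..} \<inter> C"
      unfolding closedin_closed by auto
    have "y \<notin> C"
      using C neg assms by auto
    then obtain e where e: "0 < e" "ball y e \<subseteq> - C"
      using C(1) by (meson ComplI open_Compl openE)
    \<comment> \<open>The first argument keeps \<open>z\<close> positive; both are below
      \<open>y\<close>, and the maximum is within \<open>e / 2\<close> of it.\<close>
    define z where "z = max (y / 2) (y - e / 2)"
    have z: "0 < z" "z < y" "z \<in> ball y e"
      using assms e(1) by (auto simp: z_def dist_real_def max_def)
    then have "\<not> (x, \<lambda>_. t) \<succeq> (z, \<lambda>_. s)"
      using e C by auto
    then have "(z, \<lambda>_. s) \<succeq> (x, \<lambda>_. t)"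
      using weakly_preferred_total[OF const_lottery const_lottery] assms z by blast
    \<comment> \<open>Together with the assumption, the smaller payoff \<open>z\<close> would be at
      least as good as \<open>y\<close> at the same time \<open>s + d\<close>.\<close>
    then have "(z, \<lambda>_. s + d) \<succeq> (x, \<lambda>_. t + d)"
      using assms by (intro stationarity indep_const Linf_nonneg_const)
    also note *
    finally show False
      using payoff_strict z by blast
  qed
qed

lemma ex_late_enough:
  assumes "0 < x" "0 < y"
  obtains t where "0 \<le> t" "(y, \<lambda>_. 0) \<succeq> (x, \<lambda>_. t)"
proof (rule ccontr)
  assume "\<not> thesis"
  then have less: "(x, \<lambda>_. t) \<succeq> (y, \<lambda>_. 0)" if "0 \<le> t" for t
    using that weakly_preferred_total[OF const_lottery const_lottery] assms
    by (metis order_refl \<open>\<And>t. 0 \<le> t \<Longrightarrow> (y, \<lambda>_. 0) \<succeq> (x, \<lambda>_. t) \<Longrightarrow> thesis\<close>)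
  \<comment> \<open>Payoffs beaten by \<open>x\<close> at every delay, against payoffs whose delay by one unit beats all of
    these: two closed sets that disconnect the set of payoffs.\<close>
  define A where "A = {z \<in> {0<..}. \<forall>t\<ge>0. (x, \<lambda>_. t) \<succeq> (z, \<lambda>_. 0)}"
  define B where "B = {z \<in> {0<..}. \<forall>a\<in>A. (z, \<lambda>_. 1) \<succeq> (a, \<lambda>_. 0)}"
  have "y \<in> A"
    using less assms by (auto simp: A_def)
  have "A = (\<Inter>t\<in>{0..}. {z \<in> {0<..}. (x, \<lambda>_. t) \<succeq> (z, \<lambda>_. 0)})"
    by (auto simp: A_def)
  also have "closedin (top_of_set {0<..}) \<dots>"
    using assms by (intro closedin_INT closedin_payoffs const_lottery) auto
  finally have closed_A: "closedin (top_of_set {0<..}) A" .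
  have "B = (\<Inter>a\<in>A. {z \<in> {0<..}. (z, \<lambda>_. 1) \<succeq> (a, \<lambda>_. 0)})"
    using \<open>y \<in> A\<close> by (auto simp: B_def)
  also have "closedin (top_of_set {0<..}) \<dots>"
    using \<open>y \<in> A\<close> by (intro closedin_INT closedin_payoffs const_lottery) (auto simp: A_def)
  finally have closed_B: "closedin (top_of_set {0<..}) B" .
  \<comment> \<open>A payoff outside \<open>A\<close> matches or beats \<open>x\<close> at some
    delay \<open>t\<close>. One unit later it still does so against \<open>x\<close> at
    \<open>t + 1\<close>, which is at least as good as every member of \<open>A\<close> at time
    0.\<close>
  have cover: "{0<..} \<subseteq> A \<union> B"
  proof
    fix z :: real assume z: "z \<in> {0<..}"
    show "z \<in> A \<union> B"
    proof (cases "z \<in> A")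
      case False
      then obtain t where t: "0 \<le> t" "\<not> (x, \<lambda>_. t) \<succeq> (z, \<lambda>_. 0)"
        using z by (auto simp: A_def)
      then have "(z, \<lambda>_. 0) \<succeq> (x, \<lambda>_. t)"
        using weakly_preferred_total[OF const_lottery const_lottery] assms z
        by (metis greaterThan_iff order_refl)
      then have "(z, \<lambda>_. 0 + 1) \<succeq> (x, \<lambda>_. t + 1)"
        using t assms z by (subst delay_iff) auto
      moreover have "(x, \<lambda>_. t + 1) \<succeq> (a, \<lambda>_. 0)" if "a \<in> A" for a
        using that t by (auto simp: A_def)
      ultimately have "z \<in> B"
        using z by (auto simp: B_def intro: weakly_preferred_trans)
      then show ?thesis by simp
    qed simp
  qed
  \<comment> \<open>A common element, compared with itself, would lose nothing by waiting one
    unit.\<close>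
  have disjoint: "A \<inter> B = {}"
  proof -
    have "\<not> (z, \<lambda>_. 1) \<succeq> (z, \<lambda>_. 0)" if "0 < z" for z
      using that by (simp add: time_le_iff)
    then show ?thesis by (auto simp: B_def)
  qed
  \<comment> \<open>Delayed by 1, \<open>x\<close> is worse than itself at time 0; the cover
    therefore puts it in \<open>B\<close>.\<close>
  have "x \<notin> A"
    using time_le_iff[of x 1 0] assms by (auto simp: A_def intro!: exI[of _ 1])
  then have "B \<noteq> {}"
    using cover assms by auto
  moreover have "connected {0::real<..}"
    by simp
  ultimately show False
    using closed_A closed_B cover disjoint \<open>y \<in> A\<close> unfolding connected_closedin by blast
qed

text \<open>Undelayed, the larger payoff is at least as good as the smaller; by
  \<open>ex_late_enough\<close> a long enough delay reverses this. Some delay in between equates it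
  with the smaller payoff at time 0.\<close>

lemma ex_indifferent_delays:
  assumes "0 < x" "0 < y"
  obtains a b where "0 \<le> a" "0 \<le> b" "(x, \<lambda>_. a) \<sim> (y, \<lambda>_. b)"
proof -
  have "\<exists>t\<ge>0. (z, \<lambda>_. t) \<sim> (w, \<lambda>_. 0)" if "w \<le> z" "0 < w" for z w
  proof -
    obtain c where "0 \<le> c" "(w, \<lambda>_. 0) \<succeq> (z, \<lambda>_. c)"
      using ex_late_enough[of z w] \<open>w \<le> z\<close> \<open>0 < w\<close> by auto
    moreover have "(z, \<lambda>_. 0) \<succeq> (w, \<lambda>_. 0)"
      using that by (intro payoff_mono Linf_nonneg_const) auto
    ultimately show ?thesis
      using ex_indifferent_time by metis
  qed
  then show thesis
    using that assms by (metis indifferent_sym linear order_refl)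
qed

section \<open>Logarithmic utility\<close>

text \<open>With the rate and \<open>u 1\<close> both normalised to 1, indifference reads
  \<open>u x * exp (- a) = exp (- b)\<close>, so \<open>ln (u x) = a - b\<close>. A difference, not
  a single time, is used because the logarithm may have either sign.\<close>

definition log_utility :: "real \<Rightarrow> real" where
  "log_utility x = (SOME l. \<exists>a\<ge>0. \<exists>b\<ge>0. l = a - b \<and> (x, \<lambda>_. a) \<sim> (1, \<lambda>_. b))"

lemma log_utility_delays:
  assumes "0 < x"
  obtains a b where "0 \<le> a" "0 \<le> b" "log_utility x = a - b" "(x, \<lambda>_. a) \<sim> (1, \<lambda>_. b)"
proof -
  obtain a b where "0 \<le> a" "0 \<le> b" "(x, \<lambda>_. a) \<sim> (1, \<lambda>_. b)"
    using zero_less_one by (rule ex_indifferent_delays[OF assms])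
  then have "\<exists>a'\<ge>0. \<exists>b'\<ge>0. a - b = a' - b' \<and> (x, \<lambda>_. a') \<sim> (1, \<lambda>_. b')"
    by (intro exI[of _ a] exI[of _ b]) simp
  then have "\<exists>a\<ge>0. \<exists>b\<ge>0. log_utility x = a - b \<and> (x, \<lambda>_. a) \<sim> (1, \<lambda>_. b)"
    unfolding log_utility_def by (rule someI)
  then show thesis
    by (elim exE conjE) (rule that)
qed

lemma const_preferred_iff:
  assumes "0 < x" "0 < y" "0 \<le> t" "0 \<le> s"
  shows "(x, \<lambda>_. t) \<succeq> (y, \<lambda>_. s) \<longleftrightarrow> log_utility y - s \<le> log_utility x - t"
proof -
  obtain a b where ab: "0 \<le> a" "0 \<le> b" "log_utility x = a - b" "(x, \<lambda>_. a) \<sim> (1, \<lambda>_. b)"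
    by (rule log_utility_delays[OF assms(1)])
  obtain c d where cd: "0 \<le> c" "0 \<le> d" "log_utility y = c - d" "(y, \<lambda>_. c) \<sim> (1, \<lambda>_. d)"
    by (rule log_utility_delays[OF assms(2)])
  \<comment> \<open>The common delay \<open>a + c\<close> contains the \<open>a\<close> needed to
    exchange \<open>x\<close> for payoff 1 and the \<open>c\<close> needed to exchange
    \<open>y\<close>; what remains is a comparison of times at payoff 1.\<close>
  have "(x, \<lambda>_. t) \<succeq> (y, \<lambda>_. s) \<longleftrightarrow> (x, \<lambda>_. t + (a + c)) \<succeq> (y, \<lambda>_. s + (a + c))"
    using assms ab(1) cd(1) by (intro delay_iff[symmetric]) auto
  also have "\<dots> \<longleftrightarrow> (1, \<lambda>_. b + (t + c)) \<succeq> (1, \<lambda>_. d + (s + a))"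
  proof (rule indifferent_cong)
    show "(x, \<lambda>_. t + (a + c)) \<sim> (1, \<lambda>_. b + (t + c))"
      using indifferent_delay[OF ab(4), of "t + c"] assms(3) cd(1) by (simp add: add.left_commute)
    show "(y, \<lambda>_. s + (a + c)) \<sim> (1, \<lambda>_. d + (s + a))"
      using indifferent_delay[OF cd(4), of "s + a"] assms(4) ab(1) by (simp add: ac_simps)
  qed
  also have "\<dots> \<longleftrightarrow> b + (t + c) \<le> d + (s + a)"
    using assms(3,4) ab(1,2) cd(1,2) by (intro time_le_iff) auto
  finally show ?thesis
    using ab(3) cd(3) by auto
qed

lemma log_utility_strict_mono: "strict_mono_on {0<..} log_utility"
proof (rule strict_mono_onI)
  fix x y :: real assume *: "x \<in> {0<..}" "y \<in> {0<..}" "x < y"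
  then have "\<not> (x, \<lambda>_. 0) \<succeq> (y, \<lambda>_. 0)"
    by (simp add: payoff_strict)
  then show "log_utility x < log_utility y"
    using const_preferred_iff[of x y 0 0] * by auto
qed

text \<open>Comparing \<open>x\<close> with payoff 1 at suitable times describes each superlevel and
  sublevel set, so these are closed by the continuity axiom.\<close>

lemma log_utility_continuous: "continuous_on {0<..} log_utility"
proof -
  have one: "log_utility 1 = 0"
    by (rule log_utility_delays[of 1]) (auto simp: indifferent_def time_le_iff)
  \<comment> \<open>Times cannot be negative, so the level \<open>c\<close> is split into its
    positive part, delaying \<open>x\<close>, and its negative part, delaying 1.\<close>
  have *: "(x, \<lambda>_. max c 0) \<succeq> (1, \<lambda>_. max (- c) 0) \<longleftrightarrow> c \<le> log_utility x"
    "(1, \<lambda>_. max (- c) 0) \<succeq> (x, \<lambda>_. max c 0) \<longleftrightarrow> log_utility x \<le> c" if "0 < x" for c x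
    using that by (auto simp: const_preferred_iff one)
  have ge: "closedin (top_of_set {0<..}) {x \<in> {0<..}. c \<le> log_utility x}" for c
    using closedin_payoffs(1)[of "max c 0" "(1, \<lambda>_. max (- c) 0)"]
    by (rule back_subst[where P = "closedin _"]) (auto simp: * Linf_nonneg_const)
  have le: "closedin (top_of_set {0<..}) {x \<in> {0<..}. log_utility x \<le> c}" for c
    using closedin_payoffs(2)[of "max c 0" "(1, \<lambda>_. max (- c) 0)"]
    by (rule back_subst[where P = "closedin _"]) (auto simp: * Linf_nonneg_const)
  have ev: "eventually P (at x within {0<..})"
    if "closedin (top_of_set {0<..}) {x \<in> {0<..}. \<not> P x}" "P x" "0 < x" for P and x :: real
  proof -
    have "openin (top_of_set {0<..}) {x \<in> {0<..}. P x}"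
      using that(1) openin_diff[OF openin_subtopology_self that(1)]
      by (elim back_subst[where P = "openin _"]) auto
    then obtain U where "open U" "{x \<in> {0<..}. P x} = {0<..} \<inter> U"
      unfolding openin_open by auto
    then have "x \<in> U" "\<forall>y\<in>U. y \<noteq> x \<longrightarrow> y \<in> {0<..} \<longrightarrow> P y"
      using that by auto
    then show ?thesis
      using \<open>open U\<close> unfolding eventually_at_topological by blast
  qed
  show ?thesis
    unfolding continuous_on_def
  proof (intro ballI order_tendstoI)
    fix x c :: real assume x: "x \<in> {0<..}"
    show "c < log_utility x \<Longrightarrow> eventually (\<lambda>x. c < log_utility x) (at x within {0<..})"
      using le[of c] x by (intro ev) (auto simp: not_less)
    show "log_utility x < c \<Longrightarrow> eventually (\<lambda>x. log_utility x < c) (at x within {0<..})"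
      using ge[of c] x by (intro ev) (auto simp: not_less)
  qed
qed

section \<open>The certainty equivalent as a monotone additive statistic\<close>

definition certainty_time :: "('a \<Rightarrow> real) \<Rightarrow> real" where
  "certainty_time T = (SOME t. 0 \<le> t \<and> (1, T) \<sim> (1, \<lambda>_. t))"

lemma certainty_time:
  assumes "T \<in> Linf_nonneg M"
  shows "0 \<le> certainty_time T" "(1, T) \<sim> (1, \<lambda>_. certainty_time T)"
proof -
  have "\<exists>t. 0 \<le> t \<and> (1, T) \<sim> (1, \<lambda>_. t)"
    using ex_certainty_equivalent[of 1, OF _ assms] by auto
  then have "0 \<le> certainty_time T \<and> (1, T) \<sim> (1, \<lambda>_. certainty_time T)"
    unfolding certainty_time_def by (rule someI_ex)
  then show "0 \<le> certainty_time T" "(1, T) \<sim> (1, \<lambda>_. certainty_time T)" by auto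
qed

lemma certainty_time_eq:
  assumes "(1, T) \<sim> (1, \<lambda>_. t)" "0 \<le> t"
  shows "certainty_time T = t"
proof -
  have T: "T \<in> Linf_nonneg M"
    using assms by (auto simp: indifferent_def weakly_preferred_def)
  have "(1, \<lambda>_. certainty_time T) \<sim> (1, \<lambda>_. t)"
    using certainty_time[OF T] assms indifferent_sym indifferent_trans by blast
  then show ?thesis
    using certainty_time(1)[OF T] assms(2) by (auto simp: indifferent_def time_le_iff)
qed

lemma certainty_time_any_payoff:
  assumes "0 < x" "T \<in> Linf_nonneg M"
  shows "(x, T) \<sim> (x, \<lambda>_. certainty_time T)"
proof -
  obtain t where t: "0 \<le> t" "(x, T) \<sim> (x, \<lambda>_. t)"
    using ex_certainty_equivalent assms by blast
  obtain a b where ab: "0 \<le> a" "0 \<le> b" "(x, \<lambda>_. a) \<sim> (1, \<lambda>_. b)"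
    using ex_indifferent_delays[of x 1] assms by auto
  \<comment> \<open>The chain goes from the equivalent \<open>t\<close> at payoff \<open>x\<close>
    through payoff 1 and back, ending with two deterministic times at \<open>x\<close>, which must
    coincide.\<close>
  have "(x, \<lambda>_. t + a) \<sim> (x, \<lambda>\<omega>. T \<omega> + a)"
    using indifferent_delay[OF t(2) ab(1)] by (rule indifferent_sym)
  \<comment> \<open>Here the random \<open>T\<close> is itself the common delay, added to the
    constant times \<open>a\<close> and \<open>b\<close>.\<close>
  also have "(x, \<lambda>\<omega>. T \<omega> + a) \<sim> (1, \<lambda>\<omega>. T \<omega> + b)"
    using indifferent_stationarity[OF ab(3) assms(2) indep_const(1)[OF assms(2)] indep_const(1)[OF assms(2)]]
    by (simp add: add.commute)
  also have "(1, \<lambda>\<omega>. T \<omega> + b) \<sim> (1, \<lambda>_. certainty_time T + b)"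
    using indifferent_delay[OF certainty_time(2)[OF assms(2)] ab(2)] .
  also have "\<dots> \<sim> (x, \<lambda>_. certainty_time T + a)"
    using indifferent_delay[OF indifferent_sym[OF ab(3)] certainty_time(1)[OF assms(2)]]
    by (simp add: add.commute)
  finally have "t + a = certainty_time T + a"
    using certainty_time(1)[OF assms(2)] t(1) ab(1) assms(1)
    by (auto simp: indifferent_def time_le_iff)
  with t show ?thesis by simp
qed

lemma certainty_time_statistic: "monotone_additive_statistic M certainty_time"
proof -
  have mono: "certainty_time T \<le> certainty_time S"
    if "S \<in> Linf_nonneg M" "T \<in> Linf_nonneg M" "fosd M S T" for S T
    using fosd_preferred[of 1 S T] that certainty_time[of S] certainty_time[of T]
      indifferent_cong[of "(1, T)" _ "(1, S)"]
    by (metis time_le_iff zero_less_one)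
  have meas: "T \<in> borel_measurable M" if "T \<in> Linf_nonneg M" for T :: "'a \<Rightarrow> real"
    using that by (simp add: Linf_nonneg_def)
  show ?thesis
    unfolding monotone_additive_statistic_def
  proof (intro conjI ballI allI impI)
    fix S T assume "S \<in> Linf_nonneg M" "T \<in> Linf_nonneg M" "distr M borel T = distr M borel S"
    then show "certainty_time T = certainty_time S"
      using mono fosd_if_distr_eq meas by (metis order_antisym)
  next
    fix c :: real assume "0 \<le> c"
    then show "certainty_time (\<lambda>_. c) = c"
      by (intro certainty_time_eq) (auto simp: indifferent_def time_le_iff)
  next
    fix S T assume S: "S \<in> Linf_nonneg M" and T: "T \<in> Linf_nonneg M"
      and indep: "indep_var borel T borel S"
    \<comment> \<open>The summands are replaced one at a time. Independence of \<open>T\<close> and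
      \<open>S\<close> allows \<open>T\<close> as the delay while \<open>S\<close> is replaced;
      afterwards the delay is constant.\<close>
    have "(1, \<lambda>\<omega>. T \<omega> + S \<omega>) \<sim> (1, \<lambda>\<omega>. T \<omega> + certainty_time S)"
      using indifferent_stationarity[OF certainty_time(2)[OF S] T indep indep_const(1)[OF T]]
      by (simp add: add.commute)
    also have "\<dots> \<sim> (1, \<lambda>_. certainty_time T + certainty_time S)"
      using indifferent_delay[OF certainty_time(2)[OF T] certainty_time(1)[OF S]] .
    finally show "certainty_time (\<lambda>\<omega>. T \<omega> + S \<omega>) = certainty_time T + certainty_time S"
      using certainty_time(1)[OF S] certainty_time(1)[OF T] by (intro certainty_time_eq) auto
  qed (rule mono)
qed

text \<open>Each lottery is replaced by its certainty equivalent at its own payoff, which leaves the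
  deterministic comparison.\<close>

lemma preferred_iff:
  assumes "0 < x" "0 < y" "T \<in> Linf_nonneg M" "S \<in> Linf_nonneg M"
  shows "R (x, T) (y, S) \<longleftrightarrow> log_utility y - certainty_time S \<le> log_utility x - certainty_time T"
proof -
  have "R (x, T) (y, S) \<longleftrightarrow> (x, T) \<succeq> (y, S)"
    using assms by (simp add: weakly_preferred_def)
  also have "\<dots> \<longleftrightarrow> (x, \<lambda>_. certainty_time T) \<succeq> (y, \<lambda>_. certainty_time S)"
    using assms by (intro indifferent_cong certainty_time_any_payoff)
  also have "\<dots> \<longleftrightarrow> log_utility y - certainty_time S \<le> log_utility x - certainty_time T"
    using assms by (intro const_preferred_iff certainty_time)
  finally show ?thesis .
qed

end

section \<open>From the representation back to the axioms\<close>

lemma mstp_if_represented: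
  fixes u :: "real \<Rightarrow> real"
  assumes pref: "preference_relation_on (time_lotteries M) R"
    and \<Phi>: "monotone_additive_statistic M \<Phi>" and r: "0 < r"
    and u: "\<forall>x>0. u x > 0" "continuous_on {0<..} u" "strict_mono_on {0<..} u"
    and rep: "represents_on (time_lotteries M) R (\<lambda>(x, T). u x * exp (- r * \<Phi> T))"
  shows "mstp M R"
proof -
  have R: "R (x, T) (y, S) \<longleftrightarrow> u y * exp (- r * \<Phi> S) \<le> u x * exp (- r * \<Phi> T)"
    if "0 < x" "0 < y" "T \<in> Linf_nonneg M" "S \<in> Linf_nonneg M" for x y T S
    using rep that by (simp add: represents_on_def time_lotteries_def)
  have const: "\<Phi> (\<lambda>_. c) = c" if "0 \<le> c" for c
    using \<Phi> that unfolding monotone_additive_statistic_def by blast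
  have mono: "\<Phi> T \<le> \<Phi> S" if "S \<in> Linf_nonneg M" "T \<in> Linf_nonneg M" "fosd M S T" for S T
    using \<Phi> that unfolding monotone_additive_statistic_def by blast
  have add: "\<Phi> (\<lambda>\<omega>. T \<omega> + D \<omega>) = \<Phi> T + \<Phi> D"
    if "T \<in> Linf_nonneg M" "D \<in> Linf_nonneg M" "prob_space.indep_var M borel D borel T" for T D
  \<comment> \<open>Stationarity lists \<open>D\<close> first in the independent pair, so additivity
    is applied to \<open>D + T\<close> and then commuted.\<close>
  proof -
    have "\<Phi> (\<lambda>\<omega>. D \<omega> + T \<omega>) = \<Phi> D + \<Phi> T"
      using \<Phi> that unfolding monotone_additive_statistic_def by blast
    then show ?thesis
      by (simp only: add.commute)
  qed
  have "more_is_better M R"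
    unfolding more_is_better_def strict_part_def
  proof (intro allI impI ballI)
    fix x y :: real and T assume xy: "0 < x" "0 < y" "x > y" and T: "T \<in> Linf_nonneg M"
    then have "u y < u x"
      using strict_mono_onD[OF u(3)] by simp
    then show "R (x, T) (y, T) \<and> \<not> R (y, T) (x, T)"
      using xy T by (simp add: R)
  qed
  moreover have "earlier_is_better M R"
    unfolding earlier_is_better_def strict_part_def
  proof (intro conjI allI impI ballI)
    fix x s t :: real assume xst: "0 < x" "0 \<le> s" "0 \<le> t" "s > t"
    with u(1) r have "0 < u x" "exp (- r * s) < exp (- r * t)" by auto
    with xst show "R (x, \<lambda>_. t) (x, \<lambda>_. s)" "\<not> R (x, \<lambda>_. s) (x, \<lambda>_. t)"
      by (simp_all add: R const Linf_nonneg_const)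
  next
    fix x :: real and S T
    assume xST: "0 < x" "S \<in> Linf_nonneg M" "T \<in> Linf_nonneg M" "fosd M S T"
    with u(1) r mono[of S T] have "0 < u x" "exp (- r * \<Phi> S) \<le> exp (- r * \<Phi> T)" by auto
    with xST show "R (x, T) (x, S)"
      by (simp add: R)
  qed
  moreover have "stochastic_stationarity M R"
    unfolding stochastic_stationarity_def
  proof (intro allI impI ballI)
    fix x y :: real and T S D
    assume *: "0 < x" "0 < y" "T \<in> Linf_nonneg M" "S \<in> Linf_nonneg M" "D \<in> Linf_nonneg M"
      "prob_space.indep_var M borel D borel T" "prob_space.indep_var M borel D borel S"
      and "R (x, T) (y, S)"
    then have "u y * exp (- r * \<Phi> S) \<le> u x * exp (- r * \<Phi> T)"
      using R by blast
    \<comment> \<open>By additivity, an independent delay multiplies both values by the same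
      positive factor.\<close>
    then have "u y * exp (- r * \<Phi> S) * exp (- r * \<Phi> D) \<le> u x * exp (- r * \<Phi> T) * exp (- r * \<Phi> D)"
      by (rule mult_right_mono) simp
    then have "u y * exp (- r * (\<Phi> S + \<Phi> D)) \<le> u x * exp (- r * (\<Phi> T + \<Phi> D))"
      unfolding distrib_left exp_add by (simp only: mult.assoc)
    then show "R (x, \<lambda>\<omega>. T \<omega> + D \<omega>) (y, \<lambda>\<omega>. S \<omega> + D \<omega>)"
      using * by (subst R) (simp_all only: add Linf_nonneg_add)
  qed
  moreover have "preference_continuity M R"
    unfolding preference_continuity_def
  proof (intro allI impI ballI)
    fix y :: real and S assume yS: "0 < y" "S \<in> Linf_nonneg M"
    define c where "c = u y * exp (- r * \<Phi> S)"
    let ?D = "{0<..} \<times> {0::real..}" and ?V = "\<lambda>p. u (fst p) * exp (- r * snd p)"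
    have "continuous_on ?D (\<lambda>p. u (fst p))"
      by (rule continuous_on_compose2[OF u(2)]) (auto intro: continuous_intros)
    then have V: "continuous_on ?D ?V"
      by (intro continuous_intros)
    \<comment> \<open>Since \<open>\<Phi>\<close> fixes constants, the two sets are preimages of
      closed half-lines under a continuous function of \<open>(x, t)\<close>.\<close>
    have "{(x, t) \<in> ?D. R (x, \<lambda>_. t) (y, S)} = ?D \<inter> ?V -` {c..}"
      "{(x, t) \<in> ?D. R (y, S) (x, \<lambda>_. t)} = ?D \<inter> ?V -` {..c}"
      using yS by (auto simp: R const Linf_nonneg_const c_def)
    then show "closedin (top_of_set ?D) {(x, t) \<in> ?D. R (x, \<lambda>_. t) (y, S)} \<and>
        closedin (top_of_set ?D) {(x, t) \<in> ?D. R (y, S) (x, \<lambda>_. t)}"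
      using continuous_closedin_preimage[OF V] by simp
  qed
  ultimately show ?thesis
    using pref by (simp add: mstp_def)
qed

theorem theorem3:
  fixes M :: "'a measure" and R :: "'a time_lottery \<Rightarrow> 'a time_lottery \<Rightarrow> bool"
  assumes "nonatomic_prob_space M"
    and "preference_relation_on (time_lotteries M) R"
  shows "mstp M R \<longleftrightarrow>
    (\<exists>(\<Phi> :: ('a \<Rightarrow> real) \<Rightarrow> real) (r :: real) (u :: real \<Rightarrow> real).
       monotone_additive_statistic M \<Phi> \<and>
       r > 0 \<and>
       (\<forall>x>0. u x > 0) \<and> continuous_on {0<..} u \<and> strict_mono_on {0<..} u \<and>
       represents_on (time_lotteries M) R (\<lambda>(x, T). u x * exp (- r * \<Phi> T)))"
proof
  assume "mstp M R"
  then interpret mstp_preference M R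
    using assms(1) by (simp add: mstp_preference_def mstp_preference_axioms_def nonatomic_prob_space_def)
  \<comment> \<open>\<open>log_utility\<close> is already measured in units of time, so the rate is
    1.\<close>
  let ?u = "\<lambda>x. exp (log_utility x)"
  have "continuous_on {0<..} ?u"
    using log_utility_continuous by (intro continuous_intros)
  moreover have "strict_mono_on {0<..} ?u"
    using log_utility_strict_mono by (auto simp: strict_mono_on_def)
  moreover have "represents_on (time_lotteries M) R (\<lambda>(x, T). ?u x * exp (- 1 * certainty_time T))"
    by (auto simp: represents_on_def preferred_iff simp flip: exp_add)
  ultimately show "\<exists>\<Phi> r u. monotone_additive_statistic M \<Phi> \<and> r > 0 \<and>
       (\<forall>x>0. u x > 0) \<and> continuous_on {0<..} u \<and> strict_mono_on {0<..} u \<and>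
       represents_on (time_lotteries M) R (\<lambda>(x, T). u x * exp (- r * \<Phi> T))"
    using certainty_time_statistic
    by (intro exI[of _ certainty_time] exI[of _ "1::real"] exI[of _ ?u]) auto
next
  assume "\<exists>\<Phi> r u. monotone_additive_statistic M \<Phi> \<and> r > 0 \<and>
       (\<forall>x>0. u x > 0) \<and> continuous_on {0<..} u \<and> strict_mono_on {0<..} u \<and>
       represents_on (time_lotteries M) R (\<lambda>(x, T). u x * exp (- r * \<Phi> T))"
  then show "mstp M R"
    by (elim exE conjE) (rule mstp_if_represented[OF assms(2)])
qed

end
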